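(* For every positive integer $r$ there exist simple nontrivial connected graphs $G_1,G_2,G_3,G_4$ such that $\gamma'(G_1)-\gamma(G_1)>r$, $\gamma(G_2)-\gamma'(G_2)>r$, $\gamma_{V,E}(G_3)-\gamma_{E,V}(G_3)>r$, and $\gamma_{E,V}(G_4)-\gamma_{V,E}(G_4)>r$.
   Context: An element of a graph $G=(V,E)$ is a member of $V\cup E$. Two different elements are associated if they are adjacent (two adjacent vertices, or two edges sharing an end-vertex) or incident (a vertex and an edge containing it). For $U,W\in\{V,E,V\cup E\}$, a subset $A\subseteq U$ dominates $W$ if every element of $W\setminus(A\cap W)$ is associated with some element of $A$; $\gamma_{U,W}(G)$ denotes the minimum cardinality of a subset $A\subseteq U$ dominating $W$. Notation: $\gamma(G)=\gamma_{V,V}(G)$, $\gamma'(G)=\gamma_{E,E}(G)$. *)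

theory Defs
  imports Main
begin

record 'a graph =
  verts :: "'a set"
  edges :: "'a set set"

definition simple_graph :: "'a graph \<Rightarrow> bool" where
  "simple_graph G \<longleftrightarrow> finite (verts G) \<and> (\<forall>e\<in>edges G. e \<subseteq> verts G \<and> card e = 2)"

definition nontrivial_graph :: "'a graph \<Rightarrow> bool" where
  "nontrivial_graph G \<longleftrightarrow> card (verts G) \<ge> 2"

definition adjacent :: "'a graph \<Rightarrow> 'a \<Rightarrow> 'a \<Rightarrow> bool" where
  "adjacent G u v \<longleftrightarrow> u \<noteq> v \<and> {u, v} \<in> edges G"

definition connected_graph :: "'a graph \<Rightarrow> bool" where
  "connected_graph G \<longleftrightarrow> verts G \<noteq> {} \<and> (\<forall>u\<in>verts G. \<forall>v\<in>verts G. (adjacent G)\<^sup>*\<^sup>* u v)"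

datatype 'a element = Vertex 'a | Edge "'a set"

text \<open>The sets \<open>V\<close> and \<open>E\<close> as subsets of the disjoint union \<open>V \<union> E\<close> of all elements.\<close>

definition V_elems :: "'a graph \<Rightarrow> 'a element set" where
  "V_elems G = Vertex ` verts G"

definition E_elems :: "'a graph \<Rightarrow> 'a element set" where
  "E_elems G = Edge ` edges G"

fun associated :: "'a graph \<Rightarrow> 'a element \<Rightarrow> 'a element \<Rightarrow> bool" where
  "associated G (Vertex u) (Vertex v) \<longleftrightarrow> adjacent G u v"
| "associated G (Edge e) (Edge f) \<longleftrightarrow> e \<in> edges G \<and> f \<in> edges G \<and> e \<noteq> f \<and> e \<inter> f \<noteq> {}"
| "associated G (Vertex v) (Edge e) \<longleftrightarrow> e \<in> edges G \<and> v \<in> e"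
| "associated G (Edge e) (Vertex v) \<longleftrightarrow> e \<in> edges G \<and> v \<in> e"

definition dominates :: "'a graph \<Rightarrow> 'a element set \<Rightarrow> 'a element set \<Rightarrow> bool" where
  "dominates G A W \<longleftrightarrow> (\<forall>x \<in> W - (A \<inter> W). \<exists>a\<in>A. associated G x a)"

text \<open>\<open>gamma_UW G U W\<close> is meant for \<open>U\<close>, \<open>W\<close> among \<open>V_elems G\<close>, \<open>E_elems G\<close> and their union,
  \<open>G\<close> finite. If no subset of \<open>U\<close> dominates \<open>W\<close> the value is unspecified; this does not happen
  for connected graphs with at least two vertices.\<close>

definition gamma_UW :: "'a graph \<Rightarrow> 'a element set \<Rightarrow> 'a element set \<Rightarrow> nat" where
  "gamma_UW G U W = Min (card ` {A. A \<subseteq> U \<and> dominates G A W})"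

definition gamma_VV :: "'a graph \<Rightarrow> nat" where
  "gamma_VV G = gamma_UW G (V_elems G) (V_elems G)"

definition gamma_EE :: "'a graph \<Rightarrow> nat" where
  "gamma_EE G = gamma_UW G (E_elems G) (E_elems G)"

definition gamma_VE :: "'a graph \<Rightarrow> nat" where
  "gamma_VE G = gamma_UW G (V_elems G) (E_elems G)"

definition gamma_EV :: "'a graph \<Rightarrow> nat" where
  "gamma_EV G = gamma_UW G (E_elems G) (V_elems G)"

lemma finite_edges: "simple_graph G \<Longrightarrow> finite (edges G)"
  by (rule finite_subset[of _ "Pow (verts G)"]) (auto simp: simple_graph_def)

lemma incident_edge_exists:
  assumes "simple_graph G" "nontrivial_graph G" "connected_graph G" "v \<in> verts G"
  shows "\<exists>e\<in>edges G. v \<in> e"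
proof -
  have "verts G \<noteq> {v}"
    using assms(2) by (auto simp: nontrivial_graph_def)
  then obtain w where w: "w \<in> verts G" "w \<noteq> v"
    using assms(4) by blast
  then have "(adjacent G)\<^sup>*\<^sup>* v w"
    using assms(3,4) by (auto simp: connected_graph_def)
  then obtain u where "adjacent G v u"
    using w(2) by (metis converse_rtranclpE)
  then show ?thesis
    by (auto simp: adjacent_def)
qed

lemma dominating_set_exists:
  assumes "simple_graph G" "nontrivial_graph G" "connected_graph G"
    and "U \<in> {V_elems G, E_elems G, V_elems G \<union> E_elems G}"
    and "W \<in> {V_elems G, E_elems G, V_elems G \<union> E_elems G}"
  shows "dominates G U W"
proof -
  have E: "\<exists>v\<in>verts G. v \<in> e" if "e \<in> edges G" for e
    using assms(1) that unfolding simple_graph_def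
    by (metis card.empty ex_in_conv subsetD zero_neq_numeral)
  show ?thesis
    unfolding dominates_def
  proof
    fix x assume x: "x \<in> W - (U \<inter> W)"
    show "\<exists>a\<in>U. associated G x a"
    proof (cases x)
      case (Vertex v)
      then have "v \<in> verts G" "E_elems G \<subseteq> U"
        using x assms(4,5) by (auto simp: V_elems_def E_elems_def)
      then show ?thesis
        using incident_edge_exists[OF assms(1-3), of v] Vertex by (force simp: E_elems_def)
    next
      case (Edge e)
      then have "e \<in> edges G" "V_elems G \<subseteq> U"
        using x assms(4,5) by (auto simp: V_elems_def E_elems_def)
      then show ?thesis
        using E[of e] Edge by (force simp: V_elems_def)
    qed
  qed
qed

end

theory Submission
  imports Defs
begin

text \<open>The complete graph on \<open>2m\<close> vertices serves as both \<open>G\<^sub>1\<close> and \<open>G\<^sub>3\<close>: one vertex dominates all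
  vertices and a perfect matching covers them with \<open>m\<close> edges, whereas a set of vertices or edges
  dominating all edges must miss at most one vertex. Attaching a pendant vertex to each of its
  vertices gives \<open>G\<^sub>2\<close>: the perfect matching of the core still dominates all edges, but every
  pendant edge needs an end-vertex of its own in a dominating vertex set. The star is \<open>G\<^sub>4\<close>: its
  centre meets every edge, but covering the leaves takes all edges.\<close>

section \<open>Bounding domination numbers, and counting tools\<close>

lemma finite_V_elems: "simple_graph G \<Longrightarrow> finite (V_elems G)"
  by (simp add: V_elems_def simple_graph_def)

lemma finite_E_elems: "simple_graph G \<Longrightarrow> finite (E_elems G)"
  by (simp add: E_elems_def finite_edges)

lemma gamma_UW_le:
  assumes "finite U" "A \<subseteq> U" "dominates G A W"
  shows "gamma_UW G U W \<le> card A"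
  unfolding gamma_UW_def using assms by (intro Min_le finite_imageI) auto

text \<open>That \<open>U\<close> itself dominates \<open>W\<close> makes the family of candidates
  nonempty; only then does \<open>Min\<close> return the size of an actual dominating set.\<close>

lemma gamma_UW_ge:
  assumes "finite U" "dominates G U W"
    and "\<And>A. A \<subseteq> U \<Longrightarrow> dominates G A W \<Longrightarrow> k \<le> card A"
  shows "k \<le> gamma_UW G U W"
  unfolding gamma_UW_def
proof (rule Min.boundedI)
  show "finite (card ` {A. A \<subseteq> U \<and> dominates G A W})"
    using assms(1) by simp
  show "card ` {A. A \<subseteq> U \<and> dominates G A W} \<noteq> {}"
    using assms(2) by blast
  show "k \<le> a" if "a \<in> card ` {A. A \<subseteq> U \<and> dominates G A W}" for a
    using that assms(3) by blast
qed

lemma card_image_Vertex [simp]: "card (Vertex ` S) = card S"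
  by (simp add: card_image inj_on_def)

lemma card_image_Edge [simp]: "card (Edge ` F) = card F"
  by (simp add: card_image inj_on_def)

text \<open>Adjacency is symmetric, so a path from \<open>c\<close> to \<open>u\<close> can be
  reversed and continued by one from \<open>c\<close> to \<open>v\<close>.\<close>

lemma connected_graphI:
  assumes "c \<in> verts G" "\<And>v. v \<in> verts G \<Longrightarrow> (adjacent G)\<^sup>*\<^sup>* c v"
  shows "connected_graph G"
proof -
  have "symp (adjacent G)"
    by (auto simp: symp_def adjacent_def insert_commute)
  then have "symp (adjacent G)\<^sup>*\<^sup>*"
    by (rule symp_rtranclp)
  then show ?thesis
    unfolding connected_graph_def using assms
    by (metis empty_iff rtranclp_trans sympD)
qed

lemma connected_graph_universal_vertex:
  assumes "c \<in> verts G" "\<And>v. v \<in> verts G \<Longrightarrow> v \<noteq> c \<Longrightarrow> {c, v} \<in> edges G"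
  shows "connected_graph G"
proof (rule connected_graphI[OF assms(1)])
  show "(adjacent G)\<^sup>*\<^sup>* c v" if "v \<in> verts G" for v
    using assms(2)[OF that] by (cases "v = c") (auto simp: adjacent_def)
qed

text \<open>Any two missed numbers below \<open>n\<close> would have to be equal. In a complete
  graph, \<open>S\<close> will be the set of vertices touched by an edge-dominating set: two
  distinct untouched vertices would span an undominated edge.\<close>

lemma card_ge_of_misses_at_most_one:
  assumes "finite S" "\<And>u v. u < n \<Longrightarrow> v < n \<Longrightarrow> u \<noteq> v \<Longrightarrow> u \<in> S \<or> v \<in> S"
  shows "n - 1 \<le> card (S :: nat set)"
proof -
  have "card ({..<n} - S) \<le> 1"
    using assms(2) by (auto simp: card_le_Suc0_iff_eq)
  moreover have "card {..<n} - card S \<le> card ({..<n} - S)"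
    by (rule diff_card_le_card_Diff[OF assms(1)])
  ultimately show ?thesis
    by simp
qed

section \<open>Perfect matchings and complete edge sets\<close>

definition perfect_matching :: "nat \<Rightarrow> nat set set" where
  "perfect_matching m = (\<lambda>i. {2 * i, 2 * i + 1}) ` {..<m}"

lemma card_perfect_matching_le: "card (perfect_matching m) \<le> m"
  unfolding perfect_matching_def by (metis card_image_le card_lessThan finite_lessThan)

lemma perfect_matching_covers:
  assumes "v < 2 * m"
  obtains e where "e \<in> perfect_matching m" "v \<in> e"
proof
  show "{2 * (v div 2), 2 * (v div 2) + 1} \<in> perfect_matching m"
    using assms by (auto simp: perfect_matching_def)
  show "v \<in> {2 * (v div 2), 2 * (v div 2) + 1}"
    by auto
qed

text \<open>Kept apart from the complete graph because the core of the corona reuses it.\<close>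

definition complete_edges :: "nat \<Rightarrow> nat set set" where
  "complete_edges n = {{u, v} |u v. u < n \<and> v < n \<and> u \<noteq> v}"

lemma complete_edgesI: "u < n \<Longrightarrow> v < n \<Longrightarrow> u \<noteq> v \<Longrightarrow> {u, v} \<in> complete_edges n"
  by (auto simp: complete_edges_def)

lemma complete_edges_meets_lessThan: "e \<in> complete_edges n \<Longrightarrow> \<exists>v\<in>e. v < n"
  by (auto simp: complete_edges_def)

lemma perfect_matching_subset: "perfect_matching m \<subseteq> complete_edges (2 * m)"
proof
  fix e assume "e \<in> perfect_matching m"
  then obtain i where "i < m" "e = {2 * i, 2 * i + 1}"
    by (auto simp: perfect_matching_def)
  then show "e \<in> complete_edges (2 * m)"
    by (simp add: complete_edgesI)
qed

section \<open>Complete graphs\<close>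

definition complete_graph :: "nat \<Rightarrow> nat graph" where
  "complete_graph n = \<lparr>verts = {..<n}, edges = complete_edges n\<rparr>"

lemma complete_graph_simps [simp]:
  "verts (complete_graph n) = {..<n}" "edges (complete_graph n) = complete_edges n"
  by (simp_all add: complete_graph_def)

lemma complete_graph_ok:
  assumes "n \<ge> 2"
  shows "simple_graph (complete_graph n)" "nontrivial_graph (complete_graph n)"
    "connected_graph (complete_graph n)"
proof -
  show "simple_graph (complete_graph n)"
    by (auto simp: simple_graph_def complete_edges_def)
  show "nontrivial_graph (complete_graph n)"
    using assms by (simp add: nontrivial_graph_def)
  show "connected_graph (complete_graph n)"
    using assms by (intro connected_graph_universal_vertex[of 0]) (auto intro: complete_edgesI)
qed

lemma gamma_VV_complete_graph_le:
  assumes "n \<ge> 2"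
  shows "gamma_VV (complete_graph n) \<le> 1"
proof -
  let ?A = "{Vertex 0} :: nat element set"
  have "gamma_VV (complete_graph n) \<le> card ?A"
    unfolding gamma_VV_def
  proof (rule gamma_UW_le[OF finite_V_elems[OF complete_graph_ok(1)[OF assms]]])
    show "?A \<subseteq> V_elems (complete_graph n)"
      using assms by (auto simp: V_elems_def)
    show "dominates (complete_graph n) ?A (V_elems (complete_graph n))"
      using assms by (auto simp: dominates_def V_elems_def adjacent_def intro!: complete_edgesI)
  qed
  then show ?thesis
    by simp
qed

text \<open>The edges of a dominating set together touch all vertices but at most one, and each edge
  touches only two.\<close>

lemma gamma_EE_complete_graph_ge:
  assumes "m \<ge> 1"
  shows "m \<le> gamma_EE (complete_graph (2 * m))"
  unfolding gamma_EE_def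
proof (rule gamma_UW_ge)
  let ?G = "complete_graph (2 * m)"
  have ok: "simple_graph ?G" "nontrivial_graph ?G" "connected_graph ?G"
    using complete_graph_ok[of "2 * m"] assms by simp_all
  show "finite (E_elems ?G)"
    by (rule finite_E_elems[OF ok(1)])
  show "dominates ?G (E_elems ?G) (E_elems ?G)"
    by (rule dominating_set_exists[OF ok]) auto
  fix A assume "A \<subseteq> E_elems ?G" and dom: "dominates ?G A (E_elems ?G)"
  then obtain F where F: "F \<subseteq> complete_edges (2 * m)" "A = Edge ` F"
    by (auto simp: E_elems_def subset_image_iff)
  have card2: "finite e \<and> card e = 2" if "e \<in> F" for e
    using F(1) that by (auto simp: complete_edges_def)
  have "finite F"
    using F(1) finite_edges[OF ok(1)] finite_subset by auto
  have "2 * m - 1 \<le> card (\<Union>F)"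
  proof (rule card_ge_of_misses_at_most_one)
    show "finite (\<Union>F)"
      using \<open>finite F\<close> card2 by blast
    fix u v :: nat assume uv: "u < 2 * m" "v < 2 * m" "u \<noteq> v"
    then have "Edge {u, v} \<in> E_elems ?G"
      by (simp add: E_elems_def complete_edgesI)
    then have "Edge {u, v} \<in> A \<or> (\<exists>a\<in>A. associated ?G (Edge {u, v}) a)"
      using dom by (auto simp: dominates_def)
    \<comment> \<open>Whether \<open>{u, v}\<close> is chosen itself or shares an end-vertex with a
      chosen edge, some chosen edge contains \<open>u\<close> or \<open>v\<close>.\<close>
    then show "u \<in> \<Union>F \<or> v \<in> \<Union>F"
      unfolding F(2) by auto
  qed
  also have "card (\<Union>F) \<le> (\<Sum>e\<in>F. card e)"
    by (rule card_Union_le_sum_card)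
  also have "\<dots> = 2 * card F"
    using card2 by simp
  \<comment> \<open>Parity closes the gap: \<open>2 * m - 1 \<le> 2 * card F\<close> forces
    \<open>m \<le> card F\<close>.\<close>
  finally show "m \<le> card A"
    using F(2) by simp
qed

text \<open>A vertex set dominating all edges is a vertex cover; its complement is independent,
  hence has at most one vertex in a complete graph.\<close>

lemma gamma_VE_complete_graph_ge:
  assumes "n \<ge> 2"
  shows "n - 1 \<le> gamma_VE (complete_graph n)"
  unfolding gamma_VE_def
proof (rule gamma_UW_ge)
  let ?G = "complete_graph n"
  note ok = complete_graph_ok[OF assms]
  show "finite (V_elems ?G)"
    by (rule finite_V_elems[OF ok(1)])
  show "dominates ?G (V_elems ?G) (E_elems ?G)"
    by (rule dominating_set_exists[OF ok]) auto
  fix A assume "A \<subseteq> V_elems ?G" and dom: "dominates ?G A (E_elems ?G)"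
  then obtain S where S: "S \<subseteq> {..<n}" "A = Vertex ` S"
    by (auto simp: V_elems_def subset_image_iff)
  have "n - 1 \<le> card S"
  proof (rule card_ge_of_misses_at_most_one)
    show "finite S"
      using S(1) finite_subset by blast
    fix u v :: nat assume uv: "u < n" "v < n" "u \<noteq> v"
    then have "Edge {u, v} \<in> E_elems ?G"
      by (simp add: E_elems_def complete_edgesI)
    then have "Edge {u, v} \<in> A \<or> (\<exists>a\<in>A. associated ?G (Edge {u, v}) a)"
      using dom by (auto simp: dominates_def)
    then show "u \<in> S \<or> v \<in> S"
      unfolding S(2) by auto
  qed
  then show "n - 1 \<le> card A"
    using S(2) by simp
qed

lemma gamma_EV_complete_graph_le:
  assumes "m \<ge> 1"
  shows "gamma_EV (complete_graph (2 * m)) \<le> m"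
proof -
  let ?G = "complete_graph (2 * m)" and ?A = "Edge ` perfect_matching m"
  have "gamma_EV ?G \<le> card ?A"
    unfolding gamma_EV_def
  proof (rule gamma_UW_le)
    show "finite (E_elems ?G)"
      using complete_graph_ok[of "2 * m"] assms by (simp add: finite_E_elems)
    show "?A \<subseteq> E_elems ?G"
      using perfect_matching_subset by (auto simp: E_elems_def)
    have "\<exists>a\<in>?A. associated ?G (Vertex v) a" if v: "v < 2 * m" for v
    proof -
      obtain e where e: "e \<in> perfect_matching m" "v \<in> e"
        using perfect_matching_covers[OF v] .
      then have "associated ?G (Vertex v) (Edge e)"
        using perfect_matching_subset by auto
      then show ?thesis
        using e(1) by blast
    qed
    then show "dominates ?G ?A (V_elems ?G)"
      by (auto simp: dominates_def V_elems_def)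
  qed
  then show ?thesis
    using card_perfect_matching_le[of m] by simp
qed

section \<open>Coronas of complete graphs\<close>

text \<open>The core vertex \<open>i < n\<close> carries the pendant vertex \<open>i + n\<close>, so
  reduction modulo \<open>n\<close> sends both to \<open>i\<close>.\<close>

definition corona_graph :: "nat \<Rightarrow> nat graph" where
  "corona_graph n = \<lparr>verts = {..<2 * n}, edges = complete_edges n \<union> {{i, i + n} |i. i < n}\<rparr>"

lemma corona_graph_simps [simp]:
  "verts (corona_graph n) = {..<2 * n}"
  "edges (corona_graph n) = complete_edges n \<union> {{i, i + n} |i. i < n}"
  by (simp_all add: corona_graph_def)

lemma corona_graph_ok:
  assumes "n \<ge> 1"
  shows "simple_graph (corona_graph n)" "nontrivial_graph (corona_graph n)"
    "connected_graph (corona_graph n)"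
proof -
  let ?G = "corona_graph n"
  show "simple_graph ?G"
    by (auto simp: simple_graph_def complete_edges_def card_insert_if)
  show "nontrivial_graph ?G"
    using assms by (simp add: nontrivial_graph_def)
  show "connected_graph ?G"
  proof (rule connected_graphI)
    show "0 \<in> verts ?G"
      using assms by simp
    have core: "(adjacent ?G)\<^sup>*\<^sup>* 0 v" if "v < n" for v
    proof (cases "v = 0")
      case False
      then have "adjacent ?G 0 v"
        using that assms by (simp add: adjacent_def complete_edgesI)
      then show ?thesis
        by blast
    qed simp
    show "(adjacent ?G)\<^sup>*\<^sup>* 0 v" if "v \<in> verts ?G" for v
    proof (cases "v < n")
      case False
      \<comment> \<open>The second fact puts the edge from the pendant vertex \<open>v\<close> to
        its core vertex into the form used in the definition of the edge set.\<close>
      then have "v - n < n" "{v - n, v} = {v - n, (v - n) + n}"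
        using that by auto
      then have "adjacent ?G (v - n) v"
        using False by (auto simp: adjacent_def)
      then show ?thesis
        using core[OF \<open>v - n < n\<close>] by (rule rtranclp.rtrancl_into_rtrancl[rotated])
    qed (rule core)
  qed
qed

text \<open>A pendant vertex is dominated only by itself or its core neighbour. These
  \<open>n\<close> pairs are disjoint, and each must meet the dominating set; the map
  \<open>v mod n\<close> counts them.\<close>

lemma gamma_VV_corona_graph_ge:
  assumes "n \<ge> 1"
  shows "n \<le> gamma_VV (corona_graph n)"
  unfolding gamma_VV_def
proof (rule gamma_UW_ge)
  let ?G = "corona_graph n"
  note ok = corona_graph_ok[OF assms]
  show "finite (V_elems ?G)"
    by (rule finite_V_elems[OF ok(1)])
  show "dominates ?G (V_elems ?G) (V_elems ?G)"
    by (rule dominating_set_exists[OF ok]) auto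
  fix A assume "A \<subseteq> V_elems ?G" and dom: "dominates ?G A (V_elems ?G)"
  then obtain S where S: "S \<subseteq> {..<2 * n}" "A = Vertex ` S"
    by (auto simp: V_elems_def subset_image_iff)
  have "finite S"
    using S(1) finite_subset by blast
  have "i \<in> (\<lambda>v. v mod n) ` S" if "i < n" for i
  proof -
    have "Vertex (i + n) \<in> V_elems ?G"
      using that by (auto simp: V_elems_def)
    then have "Vertex (i + n) \<in> A \<or> (\<exists>a\<in>A. associated ?G (Vertex (i + n)) a)"
      using dom by (auto simp: dominates_def)
    then have "i + n \<in> S \<or> i \<in> S"
      \<comment> \<open>No core edge contains \<open>i + n\<close>, since core vertices lie below
        \<open>n\<close>; its only edge is \<open>{i, i + n}\<close>.\<close>
      unfolding S(2) by (auto simp: adjacent_def complete_edges_def doubleton_eq_iff)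
    then show ?thesis
      using that by force
  qed
  then have "card {..<n} \<le> card ((\<lambda>v. v mod n) ` S)"
    using \<open>finite S\<close> by (intro card_mono) auto
  also have "\<dots> \<le> card S"
    by (rule card_image_le[OF \<open>finite S\<close>])
  finally show "n \<le> card A"
    using S(2) by simp
qed

text \<open>Every edge, pendant or not, has an end-vertex in the core, and the matching covers the
  core.\<close>

lemma gamma_EE_corona_graph_le:
  assumes "m \<ge> 1"
  shows "gamma_EE (corona_graph (2 * m)) \<le> m"
proof -
  let ?G = "corona_graph (2 * m)" and ?A = "Edge ` perfect_matching m"
  have "gamma_EE ?G \<le> card ?A"
    unfolding gamma_EE_def
  proof (rule gamma_UW_le)
    show "finite (E_elems ?G)"
      using corona_graph_ok[of "2 * m"] assms by (simp add: finite_E_elems)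
    show "?A \<subseteq> E_elems ?G"
      using perfect_matching_subset by (auto simp: E_elems_def)
    have "e \<in> perfect_matching m \<or> (\<exists>a\<in>?A. associated ?G (Edge e) a)"
      if e: "e \<in> edges ?G" for e
    proof -
      obtain v where v: "v \<in> e" "v < 2 * m"
        using e complete_edges_meets_lessThan[of e "2 * m"] by auto
      obtain f where f: "f \<in> perfect_matching m" "v \<in> f"
        using perfect_matching_covers[OF v(2)] .
      have "f \<in> edges ?G"
        using f(1) perfect_matching_subset by auto
      then have "e = f \<or> associated ?G (Edge e) (Edge f)"
        using e v(1) f(2) by (auto simp del: corona_graph_simps)
      then show ?thesis
        using f(1) by blast
    qed
    then show "dominates ?G ?A (E_elems ?G)"
      unfolding dominates_def E_elems_def by blast
  qed
  then show ?thesis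
    using card_perfect_matching_le[of m] by simp
qed

section \<open>Stars\<close>

definition star_graph :: "nat \<Rightarrow> nat graph" where
  "star_graph n = \<lparr>verts = {..n}, edges = (\<lambda>i. {0, i}) ` {1..n}\<rparr>"

lemma star_graph_simps [simp]:
  "verts (star_graph n) = {..n}" "edges (star_graph n) = (\<lambda>i. {0, i}) ` {1..n}"
  by (simp_all add: star_graph_def)

lemma star_graph_ok:
  assumes "n \<ge> 1"
  shows "simple_graph (star_graph n)" "nontrivial_graph (star_graph n)"
    "connected_graph (star_graph n)"
proof -
  show "simple_graph (star_graph n)"
    by (auto simp: simple_graph_def card_insert_if)
  show "nontrivial_graph (star_graph n)"
    using assms by (simp add: nontrivial_graph_def)
  show "connected_graph (star_graph n)"
    by (rule connected_graph_universal_vertex[of 0]) auto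
qed

lemma gamma_VE_star_graph_le:
  assumes "n \<ge> 1"
  shows "gamma_VE (star_graph n) \<le> 1"
proof -
  let ?A = "{Vertex 0} :: nat element set"
  have "gamma_VE (star_graph n) \<le> card ?A"
    unfolding gamma_VE_def
  proof (rule gamma_UW_le[OF finite_V_elems[OF star_graph_ok(1)[OF assms]]])
    show "?A \<subseteq> V_elems (star_graph n)"
      by (auto simp: V_elems_def)
    show "dominates (star_graph n) ?A (E_elems (star_graph n))"
      by (auto simp: dominates_def E_elems_def)
  qed
  then show ?thesis
    by simp
qed

text \<open>The leaf \<open>i\<close> lies on the single edge \<open>{0, i}\<close>, so every edge
  must be chosen, and distinct leaves give distinct edges.\<close>

lemma gamma_EV_star_graph_ge:
  assumes "n \<ge> 1"
  shows "n \<le> gamma_EV (star_graph n)"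
  unfolding gamma_EV_def
proof (rule gamma_UW_ge)
  let ?G = "star_graph n"
  note ok = star_graph_ok[OF assms]
  show fin: "finite (E_elems ?G)"
    by (rule finite_E_elems[OF ok(1)])
  show "dominates ?G (E_elems ?G) (V_elems ?G)"
    by (rule dominating_set_exists[OF ok]) auto
  fix A assume A: "A \<subseteq> E_elems ?G" and dom: "dominates ?G A (V_elems ?G)"
  have "Edge {0, i} \<in> A" if "i \<in> {1..n}" for i
  proof -
    have "Vertex i \<in> V_elems ?G" "Vertex i \<notin> A"
      using that A by (auto simp: V_elems_def E_elems_def)
    then obtain a where "a \<in> A" "associated ?G (Vertex i) a"
      using dom by (auto simp: dominates_def)
    then show ?thesis
      using A that by (auto simp: E_elems_def)
  qed
  then have "card ((\<lambda>i. Edge {0, i}) ` {1..n}) \<le> card A"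
    using finite_subset[OF A fin] by (intro card_mono) auto
  moreover have "inj_on (\<lambda>i. Edge {0, i}) {1..n}"
    by (auto simp: inj_on_def doubleton_eq_iff)
  ultimately show "n \<le> card A"
    by (simp add: card_image)
qed

section \<open>Choice of the four graphs\<close>

theorem theorem3:
  fixes r :: nat
  assumes "r > 0"
  shows "\<exists>G\<^sub>1 G\<^sub>2 G\<^sub>3 G\<^sub>4 :: nat graph.
    (\<forall>G \<in> {G\<^sub>1, G\<^sub>2, G\<^sub>3, G\<^sub>4}. simple_graph G \<and> nontrivial_graph G \<and> connected_graph G) \<and>
    int (gamma_EE G\<^sub>1) - int (gamma_VV G\<^sub>1) > int r \<and>
    int (gamma_VV G\<^sub>2) - int (gamma_EE G\<^sub>2) > int r \<and>
    int (gamma_VE G\<^sub>3) - int (gamma_EV G\<^sub>3) > int r \<and>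
    int (gamma_EV G\<^sub>4) - int (gamma_VE G\<^sub>4) > int r"
proof -
  \<comment> \<open>The bounds make the four differences at least \<open>m - 1\<close>,
    \<open>m\<close>, \<open>m - 1\<close> and \<open>m - 1\<close>, so \<open>m = r + 2\<close> is
    the least value for which they guarantee more than \<open>r\<close>.\<close>
  define m where "m = r + 2"
  let ?K = "complete_graph (2 * m)" and ?C = "corona_graph (2 * m)" and ?S = "star_graph m"
  have m: "m \<ge> 1" "2 * m \<ge> 1" "2 * m \<ge> 2"
    by (simp_all add: m_def)
  have "\<forall>G \<in> {?K, ?C, ?K, ?S}. simple_graph G \<and> nontrivial_graph G \<and> connected_graph G"
    using complete_graph_ok[OF m(3)] corona_graph_ok[OF m(2)] star_graph_ok[OF m(1)] by simp
  moreover have "int (gamma_EE ?K) - int (gamma_VV ?K) > int r"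
    using gamma_EE_complete_graph_ge[OF m(1)] gamma_VV_complete_graph_le[OF m(3)] m_def by linarith
  moreover have "int (gamma_VV ?C) - int (gamma_EE ?C) > int r"
    using gamma_VV_corona_graph_ge[OF m(2)] gamma_EE_corona_graph_le[OF m(1)] m_def by linarith
  moreover have "int (gamma_VE ?K) - int (gamma_EV ?K) > int r"
    using gamma_VE_complete_graph_ge[OF m(3)] gamma_EV_complete_graph_le[OF m(1)] m_def by linarith
  moreover have "int (gamma_EV ?S) - int (gamma_VE ?S) > int r"
    using gamma_EV_star_graph_ge[OF m(1)] gamma_VE_star_graph_le[OF m(1)] m_def by linarith
  ultimately show ?thesis
    by (intro exI[of _ ?K] exI[of _ ?C] exI[of _ ?S] conjI)
qed

end
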